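(* The Euler–Chang–Cooper scheme $$(I-\delta t\,A)f^{m}=f^{m-1}+\delta t\,Q(f^{m-1};\bar\alpha)$$ on the periodic grid is conservative: $\sum_{i=1}^N f_i^m=\sum_{i=1}^N f_i^{m-1}$.
   Context: Setting. $\Omega=[\Omega_a,\Omega_b]$ is an interval with its end points identified (a torus). $b\in\mathbb{R}$, $\sigma^2>0$, $B=-b$, $C=\sigma^2/2>0$, $\delta t>0$. The space grid is $x_i=\Omega_a+ih$, $i=0,\dots,N$, $h=(\Omega_b-\Omega_a)/N$, $N\ge 3$; since $x_0$ and $x_N$ are identified, grid functions are vectors $f=(f_1,\dots,f_N)^\top\in\mathbb{R}^N$ with indices read modulo $N$. Matrix $A$ (Chang–Cooper discretization of $f\mapsto\partial_x(Bf+C\partial_x f)$): let $\omega=\exp(hB/C)$ and $\beta=B/(\omega-1)$ (with $\beta=C/h$ if $B=0$), so $\beta>0$. $A\in\mathbb{R}^{N\times N}$ has entries $A_{i,i}=-\beta(1+\omega)/h$, $A_{i,i-1}=\beta/h$, $A_{i,i+1}=\omega\beta/h$, $A_{1,N}=\beta/h$, $A_{N,1}=\omega\beta/h$, and all other entries $0$. Jump term: $\bar\alpha=(\alpha_1,\dots,\alpha_{N_\Theta})$ with $\alpha_j\ge0$. $\Delta=(\Omega_b-\Omega_a)/N_\Theta$, $\theta_j=\Omega_a+\Delta(j-1)$, and $\Theta_j$ is the hat function on the torus $\Theta_j(s)=1+(s-\theta_j)/\Delta$ on $[\theta_j-\Delta,\theta_j]$, $\Theta_j(s)=1-(s-\theta_j)/\Delta$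 on $[\theta_j,\theta_j+\Delta]$, zero elsewhere (extended periodically, $\Theta_1\equiv\Theta_{N_\Theta+1}$). With $s_k=x_k$, put $\theta_{jk}=\Theta_j(s_k)\ge0$. For a grid function $f$, $\hat f_{ik}$ is $f$ translated by $s_k$ and continued by periodicity, i.e. $\hat f_{ik}=f_{i+\sigma_k}$ (index mod $N$), where the integer $\sigma_k$ is the number of grid cells of the translation by $s_k$ ($\sigma_k=s_k/h$ when $0$ is a grid point; the result does not depend on which integers $\sigma_k$ are used). Then $Q(f;\bar\alpha)\in\mathbb{R}^N$ is given by $$Q(f;\bar\alpha)_i=h\sum_{j=1}^{N_\Theta}\alpha_j\sum_{k=1}^N\hat f_{ik}\,\theta_{jk}-a f_i,\qquad a=h\sum_{j=1}^{N_\Theta}\alpha_j\sum_{k=1}^N\theta_{jk}.$$ *)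

theory Defs
  imports "HOL-Analysis.Infinite_Sum" "Jordan_Normal_Form.Matrix"
begin

text \<open>
  Grid functions are vectors of dimension \<open>N\<close>. The entries of vectors and matrices of the library
  are numbered from 0, so the entry with number \<open>r\<close> is the mathematical component \<open>i = r + 1\<close>, with
  \<open>i\<close> ranging over \<open>1, \<dots>, N\<close>. The function \<open>grid_at f i\<close> is \<open>f\<^sub>i\<close> with the index read modulo \<open>N\<close>.
\<close>

definition grid_at :: "real vec \<Rightarrow> int \<Rightarrow> real" where
  "grid_at f i = f $ nat ((i - 1) mod int (dim_vec f))"

definition grid_step :: "real \<Rightarrow> real \<Rightarrow> nat \<Rightarrow> real" where
  "grid_step \<Omega>a \<Omega>b N = (\<Omega>b - \<Omega>a) / real N"

definition grid_point :: "real \<Rightarrow> real \<Rightarrow> nat \<Rightarrow> nat \<Rightarrow> real" where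
  "grid_point \<Omega>a \<Omega>b N i = \<Omega>a + real i * grid_step \<Omega>a \<Omega>b N"

definition cc_omega :: "real \<Rightarrow> real \<Rightarrow> real \<Rightarrow> real" where
  "cc_omega h B C = exp (h * B / C)"

definition cc_beta :: "real \<Rightarrow> real \<Rightarrow> real \<Rightarrow> real" where
  "cc_beta h B C = (if B = 0 then C / h else B / (cc_omega h B C - 1))"

definition cc_matrix :: "nat \<Rightarrow> real \<Rightarrow> real \<Rightarrow> real \<Rightarrow> real mat" where
  "cc_matrix N h B C = mat N N (\<lambda>(r, c).
     let i = r + 1; j = c + 1; \<omega> = cc_omega h B C; \<beta> = cc_beta h B C in
     if j = i then - \<beta> * (1 + \<omega>) / h
     else if j + 1 = i then \<beta> / h
     else if j = i + 1 then \<omega> * \<beta> / h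
     else if i = 1 \<and> j = N then \<beta> / h
     else if i = N \<and> j = 1 then \<omega> * \<beta> / h
     else 0)"

definition hat_width :: "real \<Rightarrow> real \<Rightarrow> nat \<Rightarrow> real" where
  "hat_width \<Omega>a \<Omega>b N\<Theta> = (\<Omega>b - \<Omega>a) / real N\<Theta>"

definition hat_node :: "real \<Rightarrow> real \<Rightarrow> nat \<Rightarrow> nat \<Rightarrow> real" where
  "hat_node \<Omega>a \<Omega>b N\<Theta> j = \<Omega>a + hat_width \<Omega>a \<Omega>b N\<Theta> * (real j - 1)"

definition line_hat :: "real \<Rightarrow> real \<Rightarrow> real \<Rightarrow> real" where
  "line_hat \<Delta> \<theta> s =
     (if s \<in> {\<theta> - \<Delta>..\<theta>} then 1 + (s - \<theta>) / \<Delta>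
      else if s \<in> {\<theta>..\<theta> + \<Delta>} then 1 - (s - \<theta>) / \<Delta>
      else 0)"

text \<open>
  The hat function on the torus is the periodization of the hat function on the line. Only finitely
  many summands are nonzero. For at least two nodes the translates do not overlap, so this is the
  periodic extension (lemma \<open>torus_hat_eq_line_hat\<close>); for a single node the translates overlap and
  their sum is the constant 1.
\<close>

definition torus_hat :: "real \<Rightarrow> real \<Rightarrow> nat \<Rightarrow> nat \<Rightarrow> real \<Rightarrow> real" where
  "torus_hat \<Omega>a \<Omega>b N\<Theta> j s =
     (\<Sum>\<^sub>\<infinity>n::int. line_hat (hat_width \<Omega>a \<Omega>b N\<Theta>) (hat_node \<Omega>a \<Omega>b N\<Theta> j) (s + of_int n * (\<Omega>b - \<Omega>a)))"

definition jump_weight :: "real \<Rightarrow> real \<Rightarrow> nat \<Rightarrow> nat \<Rightarrow> nat \<Rightarrow> nat \<Rightarrow> real" where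
  "jump_weight \<Omega>a \<Omega>b N N\<Theta> j k = torus_hat \<Omega>a \<Omega>b N\<Theta> j (grid_point \<Omega>a \<Omega>b N k)"

definition jump_rate :: "real \<Rightarrow> real \<Rightarrow> nat \<Rightarrow> nat \<Rightarrow> (nat \<Rightarrow> real) \<Rightarrow> real" where
  "jump_rate \<Omega>a \<Omega>b N N\<Theta> \<alpha> =
     grid_step \<Omega>a \<Omega>b N * (\<Sum>j=1..N\<Theta>. \<alpha> j * (\<Sum>k=1..N. jump_weight \<Omega>a \<Omega>b N N\<Theta> j k))"

text \<open>
  The argument \<open>sh k\<close> is the number of grid cells of the translation by the grid point with number
  \<open>k\<close>.
\<close>

definition jump_term ::
  "real \<Rightarrow> real \<Rightarrow> nat \<Rightarrow> nat \<Rightarrow> (nat \<Rightarrow> int) \<Rightarrow> (nat \<Rightarrow> real) \<Rightarrow> real vec \<Rightarrow> real vec" where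
  "jump_term \<Omega>a \<Omega>b N N\<Theta> sh \<alpha> f = vec N (\<lambda>r.
     let i = int r + 1 in
     grid_step \<Omega>a \<Omega>b N *
       (\<Sum>j=1..N\<Theta>. \<alpha> j * (\<Sum>k=1..N. grid_at f (i + sh k) * jump_weight \<Omega>a \<Omega>b N N\<Theta> j k))
     - jump_rate \<Omega>a \<Omega>b N N\<Theta> \<alpha> * grid_at f i)"

lemma torus_hat_eq_line_hat:
  assumes "\<Omega>a < \<Omega>b" "N\<Theta> \<ge> 2"
    and s: "s \<in> {hat_node \<Omega>a \<Omega>b N\<Theta> j - (\<Omega>b - \<Omega>a) / 2..hat_node \<Omega>a \<Omega>b N\<Theta> j + (\<Omega>b - \<Omega>a) / 2}"
  shows "torus_hat \<Omega>a \<Omega>b N\<Theta> j s = line_hat (hat_width \<Omega>a \<Omega>b N\<Theta>) (hat_node \<Omega>a \<Omega>b N\<Theta> j) s"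
proof -
  define L where "L = \<Omega>b - \<Omega>a"
  define D where "D = hat_width \<Omega>a \<Omega>b N\<Theta>"
  define t where "t = hat_node \<Omega>a \<Omega>b N\<Theta> j"
  have L: "L > 0" using assms by (simp add: L_def)
  have "L / real N\<Theta> \<le> L / 2" using assms L by (intro divide_left_mono) auto
  moreover have D: "D > 0" using assms by (simp add: D_def hat_width_def)
  ultimately have DL: "D \<le> L / 2" by (simp add: D_def hat_width_def L_def)
  have st: "t - L / 2 \<le> s" "s \<le> t + L / 2" using s by (auto simp: t_def L_def)
  have zero: "line_hat D t (s + of_int n * L) = 0" if nz: "n \<noteq> 0" for n :: int
  proof -
    have far: "line_hat D t u = 0" if "u \<le> t - D \<or> t + D \<le> u" for u
      using that D by (auto simp: line_hat_def field_simps)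
    consider "n \<ge> 1" | "n \<le> -1" using nz by linarith
    then show ?thesis
    proof cases
      case 1
      then have "1 * L \<le> of_int n * L" using L by (intro mult_right_mono) auto
      then show ?thesis using st DL by (intro far) auto
    next
      case 2
      then have "of_int n \<le> (- 1 :: real)" by linarith
      then have "of_int n * L \<le> - 1 * L" using L by (intro mult_right_mono) auto
      then show ?thesis using st DL by (intro far) auto
    qed
  qed
  have "(\<Sum>\<^sub>\<infinity>n::int. line_hat D t (s + of_int n * L)) = (\<Sum>\<^sub>\<infinity>n\<in>{0::int}. line_hat D t (s + of_int n * L))"
    by (rule infsum_cong_neutral) (auto simp: zero)
  then show ?thesis by (simp add: torus_hat_def D_def t_def L_def)
qed

end

theory Submission
  imports Defs
begin

text \<open>
  Conservation is a statement about sums of components. Multiplying a vector by a matrix with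
  vanishing column sums produces a vector of sum zero, and the Chang--Cooper matrix is of this kind:
  being in flux form, what leaves a cell enters its two neighbours (\<open>cc_matrix_column_sum\<close>).
  The jump term also has sum zero: translation on the periodic grid only permutes the components of
  a grid function (\<open>sum_grid_at_shift\<close>), so the gain part has the sum of \<open>f\<close> times the total jump
  rate, which is exactly the sum of the loss part (\<open>sum_jump_term\<close>). Summing the components of both
  sides of the scheme therefore leaves only the sums of the old and of the new grid function.
\<close>

lemma sum_grid_at_shift:
  assumes f: "f \<in> carrier_vec N"
  shows "(\<Sum>r<N. grid_at f (int r + 1 + s)) = (\<Sum>r<N. f $ r)"
proof (rule sum.reindex_bij_witness[where i = "\<lambda>r. nat ((int r - s) mod int N)"
      and j = "\<lambda>r. nat ((int r + s) mod int N)"])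
  fix r assume "r \<in> {..<N}"
  then have N: "int N > 0" and r: "int r < int N" by auto
  have lt: "nat (x mod int N) < N" for x
    using N pos_mod_bound[of "int N" x] by linarith
  have int_nat: "int (nat (x mod int N)) = x mod int N" for x
    using N by simp
  show "nat ((int (nat ((int r + s) mod int N)) - s) mod int N) = r"
    using N r by (simp add: int_nat mod_diff_left_eq)
  show "nat ((int (nat ((int r - s) mod int N)) + s) mod int N) = r"
    using N r by (simp add: int_nat mod_add_left_eq)
  show "nat ((int r + s) mod int N) \<in> {..<N}" "nat ((int r - s) mod int N) \<in> {..<N}"
    using lt by auto
  show "f $ nat ((int r + s) mod int N) = grid_at f (int r + 1 + s)"
    using f by (simp add: grid_at_def algebra_simps)
qed

lemma sum_grid_at:
  assumes "f \<in> carrier_vec N"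
  shows "(\<Sum>i=1..N. grid_at f (int i)) = (\<Sum>r<N. f $ r)"
proof -
  have "(\<Sum>i=1..N. grid_at f (int i)) = (\<Sum>r<N. grid_at f (int r + 1 + 0))"
    by (rule sum.reindex_bij_witness[where i = Suc and j = "\<lambda>i. i - 1"]) auto
  with sum_grid_at_shift[OF assms, of 0] show ?thesis by simp
qed

lemma sum_mult_mat_vec_eq_0:
  fixes M :: "'a::comm_semiring_0 mat"
  assumes "M \<in> carrier_mat n k" "v \<in> carrier_vec k"
    and "\<And>c. c < k \<Longrightarrow> (\<Sum>r<n. M $$ (r, c)) = 0"
  shows "(\<Sum>r<n. (M *\<^sub>v v) $ r) = 0"
proof -
  have "(\<Sum>r<n. (M *\<^sub>v v) $ r) = (\<Sum>r<n. \<Sum>c<k. M $$ (r, c) * v $ c)"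
    using assms(1,2) by (auto simp: scalar_prod_def atLeast0LessThan intro!: sum.cong)
  also have "\<dots> = (\<Sum>c<k. (\<Sum>r<n. M $$ (r, c)) * v $ c)"
    by (subst sum.swap) (simp add: sum_distrib_right)
  also have "\<dots> = 0" using assms(3) by simp
  finally show ?thesis .
qed

text \<open>
  In each column only the diagonal entry and those in the two cyclically adjacent rows can be
  nonzero. With at least three grid points these rows are distinct, and the off-diagonal
  \<open>\<beta> + \<omega>\<beta>\<close> balances the diagonal \<open>- \<beta> (1 + \<omega>)\<close>.
\<close>

lemma cc_matrix_column_sum:
  assumes "N \<ge> 3" "c < N"
  shows "(\<Sum>r<N. cc_matrix N h B C $$ (r, c)) = 0"
proof -
  define \<omega> where "\<omega> = cc_omega h B C"
  define \<beta> where "\<beta> = cc_beta h B C"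
  define p where "p = (if c + 1 = N then 0 else c + 1)"
  define q where "q = (if c = 0 then N - 1 else c - 1)"
  have "cc_matrix N h B C $$ (r, c) =
      (if r = c then - \<beta> * (1 + \<omega>) / h else 0) +
      (if r = p then \<beta> / h else 0) + (if r = q then \<omega> * \<beta> / h else 0)" if "r < N" for r
    using assms that by (auto simp: cc_matrix_def Let_def \<omega>_def \<beta>_def p_def q_def)
  then have "(\<Sum>r<N. cc_matrix N h B C $$ (r, c)) =
      (\<Sum>r<N. if r = c then - \<beta> * (1 + \<omega>) / h else 0) +
      (\<Sum>r<N. if r = p then \<beta> / h else 0) + (\<Sum>r<N. if r = q then \<omega> * \<beta> / h else 0)"
    by (simp add: sum.distrib)
  moreover have "p < N" "q < N" using assms by (auto simp: p_def q_def)
  ultimately have "(\<Sum>r<N. cc_matrix N h B C $$ (r, c)) =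
      - \<beta> * (1 + \<omega>) / h + \<beta> / h + \<omega> * \<beta> / h"
    using \<open>c < N\<close> by simp
  also have "\<dots> = 0" by (simp add: add_divide_distrib[symmetric] algebra_simps)
  finally show ?thesis .
qed

lemma sum_jump_term:
  assumes f: "f \<in> carrier_vec N"
  shows "(\<Sum>r<N. jump_term \<Omega>a \<Omega>b N N\<Theta> sh \<alpha> f $ r) = 0"
proof -
  let ?h = "grid_step \<Omega>a \<Omega>b N" and ?w = "jump_weight \<Omega>a \<Omega>b N N\<Theta>"
  let ?S = "\<Sum>r<N. f $ r"
  have "(\<Sum>r<N. \<Sum>j=1..N\<Theta>. \<alpha> j * (\<Sum>k=1..N. grid_at f (int r + 1 + sh k) * ?w j k))
      = (\<Sum>j=1..N\<Theta>. \<alpha> j * (\<Sum>k=1..N. \<Sum>r<N. grid_at f (int r + 1 + sh k) * ?w j k))"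
    by (subst sum.swap, simp only: sum_distrib_left[symmetric], subst sum.swap, rule refl)
  also have "\<dots> = (\<Sum>j=1..N\<Theta>. \<alpha> j * (\<Sum>k=1..N. ?S * ?w j k))"
    by (simp only: sum_distrib_right[symmetric] sum_grid_at_shift[OF f])
  also have "\<dots> = (\<Sum>j=1..N\<Theta>. \<alpha> j * (\<Sum>k=1..N. ?w j k)) * ?S"
    by (simp add: sum_distrib_left sum_distrib_right mult_ac)
  finally have gain: "(\<Sum>r<N. \<Sum>j=1..N\<Theta>. \<alpha> j * (\<Sum>k=1..N. grid_at f (int r + 1 + sh k) * ?w j k))
      = (\<Sum>j=1..N\<Theta>. \<alpha> j * (\<Sum>k=1..N. ?w j k)) * ?S" .
  have "(\<Sum>r<N. jump_term \<Omega>a \<Omega>b N N\<Theta> sh \<alpha> f $ r)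
      = ?h * (\<Sum>r<N. \<Sum>j=1..N\<Theta>. \<alpha> j * (\<Sum>k=1..N. grid_at f (int r + 1 + sh k) * ?w j k))
        - jump_rate \<Omega>a \<Omega>b N N\<Theta> \<alpha> * (\<Sum>r<N. grid_at f (int r + 1))"
    by (simp add: jump_term_def Let_def sum_subtractf sum_distrib_left)
  also have "\<dots> = 0"
    unfolding gain jump_rate_def using sum_grid_at_shift[OF f, of 0] by simp
  finally show ?thesis .
qed

theorem mainTheorem5:
  fixes \<Omega>a \<Omega>b b \<sigma> \<delta>t :: real
    and N N\<Theta> m :: nat
    and \<alpha> :: "nat \<Rightarrow> real"
    and sh :: "nat \<Rightarrow> int"
    and f :: "nat \<Rightarrow> real vec"
  assumes "\<Omega>a < \<Omega>b" and "N \<ge> 3" and "N\<Theta> \<ge> 1"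
    and "\<sigma>\<^sup>2 > 0" and "\<delta>t > 0"
    and "\<And>j. j \<in> {1..N\<Theta>} \<Longrightarrow> \<alpha> j \<ge> 0"
    and "m \<ge> 1" and "f (m - 1) \<in> carrier_vec N" and "f m \<in> carrier_vec N"
    and "(1\<^sub>m N - \<delta>t \<cdot>\<^sub>m cc_matrix N (grid_step \<Omega>a \<Omega>b N) (- b) (\<sigma>\<^sup>2 / 2)) *\<^sub>v f m
         = f (m - 1) + \<delta>t \<cdot>\<^sub>v jump_term \<Omega>a \<Omega>b N N\<Theta> sh \<alpha> (f (m - 1))"
  shows "(\<Sum>i=1..N. grid_at (f m) (int i)) = (\<Sum>i=1..N. grid_at (f (m - 1)) (int i))"
proof -
  let ?A = "cc_matrix N (grid_step \<Omega>a \<Omega>b N) (- b) (\<sigma>\<^sup>2 / 2)"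
  let ?Q = "jump_term \<Omega>a \<Omega>b N N\<Theta> sh \<alpha> (f (m - 1))"
  have A: "?A \<in> carrier_mat N N" by (simp add: cc_matrix_def)
  have Q: "?Q \<in> carrier_vec N" by (simp add: jump_term_def)
  note new = \<open>f m \<in> carrier_vec N\<close> and old = \<open>f (m - 1) \<in> carrier_vec N\<close>
  have "(1\<^sub>m N - \<delta>t \<cdot>\<^sub>m ?A) *\<^sub>v f m = f m - \<delta>t \<cdot>\<^sub>v (?A *\<^sub>v f m)"
    unfolding minus_mult_distrib_mat_vec[OF one_carrier_mat smult_carrier_mat[OF A] new]
    using A new by (auto intro!: eq_vecI simp: scalar_prod_def sum_distrib_left mult.assoc)
  with assms(10) have scheme: "f m - \<delta>t \<cdot>\<^sub>v (?A *\<^sub>v f m) = f (m - 1) + \<delta>t \<cdot>\<^sub>v ?Q" by simp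
  have "f m $ r - \<delta>t * (?A *\<^sub>v f m) $ r = f (m - 1) $ r + \<delta>t * ?Q $ r" if "r < N" for r
    using arg_cong[OF scheme, of "\<lambda>v. v $ r"] A Q new old that by simp
  then have "(\<Sum>r<N. f m $ r - \<delta>t * (?A *\<^sub>v f m) $ r) = (\<Sum>r<N. f (m - 1) $ r + \<delta>t * ?Q $ r)"
    by simp
  then have "(\<Sum>r<N. f m $ r) - \<delta>t * (\<Sum>r<N. (?A *\<^sub>v f m) $ r)
      = (\<Sum>r<N. f (m - 1) $ r) + \<delta>t * (\<Sum>r<N. ?Q $ r)"
    by (simp only: sum_subtractf sum.distrib sum_distrib_left)
  moreover have "(\<Sum>r<N. (?A *\<^sub>v f m) $ r) = 0"
    using A new cc_matrix_column_sum[OF \<open>N \<ge> 3\<close>] by (rule sum_mult_mat_vec_eq_0)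
  ultimately show ?thesis
    using sum_jump_term[OF old] sum_grid_at[OF new] sum_grid_at[OF old] by simp
qed

end
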